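(* Let $E$ be a finite set and let $X(\cdot)$ be a continuous-time Markov chain on $E$, with semigroup $(\mathbf P_t)_{t\ge0}$, that has only one irreducible class. Let $\mu,\nu$ be probability measures on $E$ with $\mu\ne\nu$. Then for every $t>0$, $$d_{\rm TV}(\mu,\nu)>d_{\rm TV}(\mu\mathbf P_t,\nu\mathbf P_t).$$ In particular, if $\nu$ is a stationary distribution, then for every $t>0$, $d_{\rm TV}(\mu,\nu)>d_{\rm TV}(\mu\mathbf P_t,\nu)$.
   Context: On a finite set, $d_{\rm TV}(\mu,\nu)=\sup_{A\subset E}|\mu(A)-\nu(A)|=\frac12\sum_{x\in E}|\mu(x)-\nu(x)|$. $\mu\mathbf P_t$ is the law of $X(t)$ when $X(0)$ has law $\mu$. "Only one irreducible class" means exactly one closed (recurrent) irreducible class; transient states are allowed. *)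

theory Defs
  imports "HOL-Probability.Probability"
begin

text \<open>
  The finite state space is a type \<^typ>\<open>'e::finite\<close>, and probability measures on it are values
  of type \<^typ>\<open>'e pmf\<close>. The value \<^term>\<open>P t x\<close> of a semigroup is row \<open>x\<close> of
  the stochastic matrix \<open>P\<^sub>t\<close>; it is meaningful for \<open>t \<ge> 0\<close> only. Continuity at \<open>0\<close>
  is the usual requirement that the chain stays in each state for a positive time.
\<close>

locale transition_semigroup =
  fixes P :: "real \<Rightarrow> 'e::finite \<Rightarrow> 'e pmf"
  assumes zero: "P 0 x = return_pmf x"
    and Chapman_Kolmogorov:
      "0 \<le> s \<Longrightarrow> 0 \<le> t \<Longrightarrow> P (s + t) x = bind_pmf (P s x) (P t)"
    and continuous_at_zero: "((\<lambda>t. pmf (P t x) x) \<longlongrightarrow> 1) (at_right 0)"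

text \<open>
  \<^term>\<open>Pr \<mu>\<close> is the probability measure on the sample space under which the chain starts
  from the law \<open>\<mu>\<close>. The Markov property is stated for cylinder events of the past, and in
  product form, so that no conditioning on null events occurs. Regularity of the sample paths is
  not required.
\<close>

locale ctmc = transition_semigroup P
  for P :: "real \<Rightarrow> 'e::finite \<Rightarrow> 'e pmf" +
  fixes Pr :: "'e pmf \<Rightarrow> 'w measure" and X :: "real \<Rightarrow> 'w \<Rightarrow> 'e"
  assumes prob_space_Pr: "prob_space (Pr \<mu>)"
    and measurable_X: "0 \<le> t \<Longrightarrow> X t \<in> measurable (Pr \<mu>) (count_space UNIV)"
    and initial_law: "distr (Pr \<mu>) (count_space UNIV) (X 0) = measure_pmf \<mu>"
    and Markov: "0 \<le> s \<Longrightarrow> 0 \<le> t \<Longrightarrow> finite T \<Longrightarrow> T \<subseteq> {0..s} \<Longrightarrow>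
      measure (Pr \<mu>)
        {\<omega> \<in> space (Pr \<mu>). (\<forall>r\<in>T. X r \<omega> = z r) \<and> X s \<omega> = x \<and> X (s + t) \<omega> = y} =
      measure (Pr \<mu>) {\<omega> \<in> space (Pr \<mu>). (\<forall>r\<in>T. X r \<omega> = z r) \<and> X s \<omega> = x} *
        pmf (P t x) y"

definition law_at :: "('e pmf \<Rightarrow> 'w measure) \<Rightarrow> (real \<Rightarrow> 'w \<Rightarrow> 'e) \<Rightarrow> 'e pmf \<Rightarrow> real \<Rightarrow> 'e measure"
  where "law_at Pr X \<mu> t = distr (Pr \<mu>) (count_space UNIV) (X t)"

text \<open>The law at time \<open>t\<close> is the row vector \<open>\<mu>\<close> times the matrix \<open>P\<^sub>t\<close>.\<close>

lemma (in ctmc) law_at_eq_bind_pmf: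
  assumes t: "0 \<le> t"
  shows "law_at Pr X \<mu> t = measure_pmf (bind_pmf \<mu> (P t))"
proof -
  interpret prob_space "Pr \<mu>" by (rule prob_space_Pr)
  note [measurable] = measurable_X[OF t] measurable_X[OF order_refl]
  interpret D: prob_space "distr (Pr \<mu>) (count_space UNIV) (X t)"
    by (rule prob_space_distr) measurable
  have init: "measure (Pr \<mu>) {\<omega> \<in> space (Pr \<mu>). X 0 \<omega> = x} = pmf \<mu> x" for x
  proof -
    have "measure (Pr \<mu>) {\<omega> \<in> space (Pr \<mu>). X 0 \<omega> = x} =
      measure (distr (Pr \<mu>) (count_space UNIV) (X 0)) {x}"
      by (subst measure_distr) (auto intro!: arg_cong[where f = "measure (Pr \<mu>)"])
    then show ?thesis by (simp add: initial_law pmf.rep_eq)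
  qed
  have trans: "measure (Pr \<mu>) {\<omega> \<in> space (Pr \<mu>). X t \<omega> = y} = pmf (bind_pmf \<mu> (P t)) y" for y
  proof -
    have "measure (Pr \<mu>) {\<omega> \<in> space (Pr \<mu>). X t \<omega> = y} =
      measure (Pr \<mu>) (\<Union>x\<in>UNIV. {\<omega> \<in> space (Pr \<mu>). X 0 \<omega> = x \<and> X t \<omega> = y})"
      by (auto intro!: arg_cong[where f = "measure (Pr \<mu>)"])
    also have "\<dots> = (\<Sum>x\<in>UNIV. measure (Pr \<mu>) {\<omega> \<in> space (Pr \<mu>). X 0 \<omega> = x \<and> X t \<omega> = y})"
      by (intro finite_measure_finite_Union) (auto simp: disjoint_family_on_def)
    also have "\<dots> = (\<Sum>x\<in>UNIV. pmf \<mu> x * pmf (P t x) y)"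
      using Markov[of 0 t "{}" \<mu>] t init by (intro sum.cong) auto
    finally show ?thesis
      by (simp add: pmf_bind integral_measure_pmf[of UNIV])
  qed
  have "emeasure (distr (Pr \<mu>) (count_space UNIV) (X t)) {y} =
      emeasure (measure_pmf (bind_pmf \<mu> (P t))) {y}" for y
  proof -
    have "measure (distr (Pr \<mu>) (count_space UNIV) (X t)) {y} =
      measure (Pr \<mu>) {\<omega> \<in> space (Pr \<mu>). X t \<omega> = y}"
      by (subst measure_distr) (auto intro!: arg_cong[where f = "measure (Pr \<mu>)"])
    then show ?thesis
      using trans[of y]
      by (simp add: D.emeasure_eq_measure measure_pmf.emeasure_eq_measure pmf.rep_eq)
  qed
  then show ?thesis
    unfolding law_at_def by (intro measure_eqI_countable[where A = UNIV]) auto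
qed

definition leads_to :: "(real \<Rightarrow> 'e \<Rightarrow> 'e pmf) \<Rightarrow> 'e \<Rightarrow> 'e \<Rightarrow> bool"
  where "leads_to P x y \<longleftrightarrow> (\<exists>t\<ge>0. 0 < pmf (P t x) y)"

definition closed_irreducible_class :: "(real \<Rightarrow> 'e \<Rightarrow> 'e pmf) \<Rightarrow> 'e set \<Rightarrow> bool"
  where "closed_irreducible_class P C \<longleftrightarrow>
    C \<noteq> {} \<and> (\<forall>x\<in>C. \<forall>y\<in>C. leads_to P x y) \<and> (\<forall>x\<in>C. \<forall>y. leads_to P x y \<longrightarrow> y \<in> C)"

definition stationary :: "('e pmf \<Rightarrow> 'w measure) \<Rightarrow> (real \<Rightarrow> 'w \<Rightarrow> 'e) \<Rightarrow> 'e pmf \<Rightarrow> bool"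
  where "stationary Pr X \<nu> \<longleftrightarrow> (\<forall>t\<ge>0. law_at Pr X \<nu> t = measure_pmf \<nu>)"

text \<open>For measures on the discrete \<open>\<sigma>\<close>-algebra, where every subset is an event.\<close>

definition d_TV :: "'e measure \<Rightarrow> 'e measure \<Rightarrow> real"
  where "d_TV M N = (SUP A. \<bar>measure M A - measure N A\<bar>)"

end

theory Submission
  imports Defs
begin

text \<open>
  If all rows of a stochastic matrix charge a common state \<open>z\<close> with mass at least \<open>\<epsilon>\<close>, then the
  matrix contracts the total variation distance by the factor \<open>1 - \<epsilon>\<close> (Doeblin). For a semigroup,
  the positivity pattern of \<open>P\<^sub>t\<close> increases with \<open>t\<close>, since \<open>P\<^sub>t(x, x) > 0\<close>; there are only finitely
  many patterns, so it is constant on some \<open>(0, \<delta>]\<close>. Comparing \<open>\<delta>\<close> with \<open>\<delta>/2 + \<delta>/2\<close> shows that this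
  pattern is transitive, hence it is the pattern of \<open>P\<^sub>t\<close> for every \<open>t > 0\<close>. So every state \<open>z\<close> of
  the only closed irreducible class, being reachable from everywhere, is charged by all rows of
  \<open>P\<^sub>t\<close>.
\<close>

section \<open>Total variation distance\<close>

lemma d_TV_commute: "d_TV M N = d_TV N M"
  by (simp add: d_TV_def abs_minus_commute)

text \<open>The real supremum in \<open>d_TV\<close> dominates its members only once the family is
  known to be bounded; 1 is a bound.\<close>

lemma d_TV_pmf_upper:
  "\<bar>measure (measure_pmf \<mu>) A - measure (measure_pmf \<nu>) A\<bar> \<le> d_TV (measure_pmf \<mu>) (measure_pmf \<nu>)"
  unfolding d_TV_def
proof (rule cSUP_upper)
  show "bdd_above (range (\<lambda>A. \<bar>measure (measure_pmf \<mu>) A - measure (measure_pmf \<nu>) A\<bar>))"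
  proof (rule bdd_aboveI2)
    fix A
    show "\<bar>measure (measure_pmf \<mu>) A - measure (measure_pmf \<nu>) A\<bar> \<le> 1"
      using measure_pmf.prob_le_1[of \<mu> A] measure_pmf.prob_le_1[of \<nu> A]
        measure_nonneg[of \<mu> A] measure_nonneg[of \<nu> A] by linarith
  qed
qed simp

lemma d_TV_pmf_pos:
  assumes "\<mu> \<noteq> \<nu>"
  shows "0 < d_TV (measure_pmf \<mu>) (measure_pmf \<nu>)"
proof -
  obtain x where "pmf \<mu> x \<noteq> pmf \<nu> x"
    using assms by (meson pmf_eqI)
  then have "0 < \<bar>measure (measure_pmf \<mu>) {x} - measure (measure_pmf \<nu>) {x}\<bar>"
    by (simp add: pmf.rep_eq)
  then show ?thesis
    using d_TV_pmf_upper by (rule less_le_trans)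
qed

text \<open>Dropping the terms with negative difference and raising \<open>g\<close> to
  \<open>c\<close> in the others can only increase the sum. What remains is \<open>c\<close> times
  the excess mass of \<open>\<mu>\<close> over \<open>\<nu>\<close> on the set where
  \<open>\<mu>\<close> is larger.\<close>

lemma sum_diff_mult_le_d_TV:
  fixes \<mu> \<nu> :: "'a::finite pmf" and g :: "'a \<Rightarrow> real"
  assumes g: "\<And>x. 0 \<le> g x" "\<And>x. g x \<le> c"
  shows "(\<Sum>x\<in>UNIV. (pmf \<mu> x - pmf \<nu> x) * g x) \<le> c * d_TV (measure_pmf \<mu>) (measure_pmf \<nu>)"
proof -
  define A where "A = {x. pmf \<nu> x < pmf \<mu> x}"
  have c: "0 \<le> c"
    using g order_trans by blast
  have "(\<Sum>x\<in>UNIV. (pmf \<mu> x - pmf \<nu> x) * g x)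
      \<le> (\<Sum>x\<in>UNIV. if x \<in> A then (pmf \<mu> x - pmf \<nu> x) * c else 0)"
    by (rule sum_mono) (auto simp: A_def g mult_left_mono mult_nonpos_nonneg)
  also have "\<dots> = c * (measure (measure_pmf \<mu>) A - measure (measure_pmf \<nu>) A)"
    by (simp add: sum.If_cases measure_measure_pmf_finite sum_subtractf[symmetric]
        sum_distrib_left mult.commute)
  also have "\<dots> \<le> c * d_TV (measure_pmf \<mu>) (measure_pmf \<nu>)"
    using d_TV_pmf_upper[of \<mu> A \<nu>] c by (intro mult_left_mono) auto
  finally show ?thesis .
qed

lemma measure_bind_pmf_finite:
  fixes \<mu> :: "'a::finite pmf"
  shows "measure (measure_pmf (bind_pmf \<mu> K)) A
    = (\<Sum>x\<in>UNIV. pmf \<mu> x * measure (measure_pmf (K x)) A)"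
proof -
  have "measure (measure_pmf (bind_pmf \<mu> K)) A
      = measure_pmf.expectation \<mu> (\<lambda>x. measure (measure_pmf (K x)) A)"
    unfolding measure_pmf_bind
    by (rule measure_pmf.measure_bind[where N = "count_space UNIV"])
       (auto simp: measure_pmf_in_subprob_algebra)
  then show ?thesis
    by (simp add: integral_measure_pmf[of UNIV])
qed

text \<open>The difference of two laws has total mass zero, so a constant may be subtracted from the
  function it integrates. The common mass at \<open>z\<close> lets one squeeze the row masses of
  \<open>A\<close> into an interval of length \<open>1 - \<epsilon>\<close>.\<close>

lemma d_TV_bind_pmf_le:
  fixes \<mu> \<nu> :: "'a::finite pmf"
  assumes z: "\<And>x. \<epsilon> \<le> pmf (K x) z"
  shows "d_TV (measure_pmf (bind_pmf \<mu> K)) (measure_pmf (bind_pmf \<nu> K))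
    \<le> (1 - \<epsilon>) * d_TV (measure_pmf \<mu>) (measure_pmf \<nu>)"
  unfolding d_TV_def[of "measure_pmf (bind_pmf \<mu> K)"]
proof (rule cSUP_least)
  fix A
  \<comment> \<open>If \<open>z\<close> is in \<open>A\<close>, the rows give \<open>A\<close> mass
    in \<open>[\<epsilon>, 1]\<close>; otherwise in \<open>[0, 1 - \<epsilon>]\<close>. Subtracting
    \<open>a\<close> brings both cases to \<open>[0, 1 - \<epsilon>]\<close>.\<close>
  define a where "a = (if z \<in> A then \<epsilon> else 0)"
  define g where "g x = measure (measure_pmf (K x)) A - a" for x
  have g0: "0 \<le> g x" for x
    using z[of x] measure_pmf.finite_measure_mono[of "{z}" A "K x"]
    by (auto simp: g_def a_def pmf.rep_eq)
  have g1: "g x \<le> 1 - \<epsilon>" for x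
  proof (cases "z \<in> A")
    case True
    then show ?thesis by (simp add: g_def a_def)
  next
    case False
    then have "measure (measure_pmf (K x)) A \<le> measure (measure_pmf (K x)) (UNIV - {z})"
      by (intro measure_pmf.finite_measure_mono) auto
    also have "\<dots> = 1 - pmf (K x) z"
      using measure_pmf.prob_compl[of "{z}" "K x"] by (simp add: pmf.rep_eq)
    finally show ?thesis
      using z[of x] False by (simp add: g_def a_def)
  qed
  have diff: "measure (measure_pmf (bind_pmf \<rho> K)) A - measure (measure_pmf (bind_pmf \<sigma> K)) A
      = (\<Sum>x\<in>UNIV. (pmf \<rho> x - pmf \<sigma> x) * g x)" for \<rho> \<sigma> :: "'a pmf"
  proof -
    have "(\<Sum>x\<in>UNIV. (pmf \<rho> x - pmf \<sigma> x) * g x)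
        = (\<Sum>x\<in>UNIV. pmf \<rho> x * measure (measure_pmf (K x)) A)
          - (\<Sum>x\<in>UNIV. pmf \<sigma> x * measure (measure_pmf (K x)) A)
          - a * ((\<Sum>x\<in>UNIV. pmf \<rho> x) - (\<Sum>x\<in>UNIV. pmf \<sigma> x))"
      by (simp add: g_def algebra_simps sum.distrib sum_subtractf sum_distrib_left)
    then show ?thesis
      by (simp add: measure_bind_pmf_finite sum_pmf_eq_1)
  qed
  \<comment> \<open>The laws are kept arbitrary because the bound is one-sided: the absolute value
    needs both orders of \<open>\<mu>\<close> and \<open>\<nu>\<close>.\<close>
  have "measure (measure_pmf (bind_pmf \<rho> K)) A - measure (measure_pmf (bind_pmf \<sigma> K)) A
      \<le> (1 - \<epsilon>) * d_TV (measure_pmf \<rho>) (measure_pmf \<sigma>)" for \<rho> \<sigma> :: "'a pmf"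
    unfolding diff using g0 g1 by (rule sum_diff_mult_le_d_TV)
  from this[of \<mu> \<nu>] this[of \<nu> \<mu>]
  show "\<bar>measure (measure_pmf (bind_pmf \<mu> K)) A - measure (measure_pmf (bind_pmf \<nu> K)) A\<bar>
      \<le> (1 - \<epsilon>) * d_TV (measure_pmf \<mu>) (measure_pmf \<nu>)"
    by (simp add: d_TV_commute[of "measure_pmf \<nu>"] abs_le_iff)
qed simp

section \<open>Positivity of transition probabilities\<close>

context transition_semigroup
begin

lemma set_pmf_add:
  assumes "0 \<le> s" "0 \<le> t"
  shows "set_pmf (P (s + t) x) = (\<Union>y\<in>set_pmf (P s x). set_pmf (P t y))"
  using assms by (simp add: Chapman_Kolmogorov)

lemma refl_multiple:
  assumes "0 \<le> s" "x \<in> set_pmf (P s x)"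
  shows "x \<in> set_pmf (P (real n * s) x)"
proof (induction n)
  case 0
  then show ?case by (simp add: zero)
next
  case (Suc n)
  have "P (real (Suc n) * s) x = P (s + real n * s) x"
    by (simp add: algebra_simps)
  then show ?case
    using Suc assms set_pmf_add[of s "real n * s" x] by auto
qed

text \<open>Continuity at 0 makes the diagonal entry positive for short times. Cutting
  \<open>t\<close> into \<open>n\<close> short steps, the chain can be back at \<open>x\<close>
  after each of them.\<close>

lemma in_set_pmf_refl:
  assumes "0 \<le> t"
  shows "x \<in> set_pmf (P t x)"
proof (cases "t = 0")
  case True
  then show ?thesis by (simp add: zero)
next
  case False
  with assms have t: "0 < t" by simp
  have "eventually (\<lambda>s. 0 < pmf (P s x) x) (at_right 0)"
    using continuous_at_zero by (rule order_tendstoD) simp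
  then obtain b where b: "0 < b" "\<And>s. 0 < s \<Longrightarrow> s < b \<Longrightarrow> 0 < pmf (P s x) x"
    by (auto simp: eventually_at_right_field)
  obtain n where n: "0 < n" "t / b < real n"
    using reals_Archimedean2[of "max 0 (t / b)"] by auto
  have "t / real n < b"
    using n b(1) by (simp add: field_simps)
  then have "0 < pmf (P (t / real n) x) x"
    using t n(1) by (intro b(2)) auto
  then have "x \<in> set_pmf (P (real n * (t / real n)) x)"
    using t by (intro refl_multiple) (auto simp: set_pmf_iff)
  then show ?thesis
    using n(1) by simp
qed

text \<open>A state charged at time \<open>s\<close> is still charged at time \<open>t\<close>,
  since the chain may be there again after the remaining \<open>t - s\<close>.\<close>

lemma set_pmf_mono:
  assumes "0 \<le> s" "s \<le> t"
  shows "set_pmf (P s x) \<subseteq> set_pmf (P t x)"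
proof -
  have "set_pmf (P t x) = (\<Union>y\<in>set_pmf (P s x). set_pmf (P (t - s) y))"
    using set_pmf_add[of s "t - s" x] assms by simp
  then show ?thesis
    using in_set_pmf_refl[of "t - s"] assms by auto
qed

lemma ex_constant_support:
  "\<exists>\<delta>>0. \<forall>s x. 0 < s \<longrightarrow> s \<le> \<delta> \<longrightarrow> set_pmf (P s x) = set_pmf (P \<delta> x)"
proof -
  \<comment> \<open>\<open>R t\<close> collects the supports of all rows in one relation, so that a
    single \<open>\<delta>\<close> serves every row. Choosing \<open>\<delta>\<close> with the
    fewest pairs forces equality at earlier positive times, where the relation is contained in
    \<open>R \<delta>\<close>.\<close>
  define R where "R t = (SIGMA x:UNIV. set_pmf (P t x))" for t
  obtain \<delta> :: real where \<delta>: "0 < \<delta>" "\<And>s. 0 < s \<Longrightarrow> card (R \<delta>) \<le> card (R s)"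
    using ex_has_least_nat[of "\<lambda>t::real. 0 < t" 1 "\<lambda>t. card (R t)"] by auto
  have "R s = R \<delta>" if "0 < s" "s \<le> \<delta>" for s
  proof (rule card_seteq)
    show "R s \<subseteq> R \<delta>"
      using set_pmf_mono[of s \<delta>] that by (auto simp: R_def)
  qed (use \<delta>(2)[OF that(1)] in simp_all)
  moreover have "set_pmf (P t x) = R t `` {x}" for t x
    by (auto simp: R_def)
  ultimately show ?thesis
    using \<delta>(1) by auto
qed

lemma set_pmf_time_independent:
  assumes "0 < s" "0 < t"
  shows "set_pmf (P s x) = set_pmf (P t x)"
proof -
  obtain \<delta> where \<delta>: "0 < \<delta>" "\<And>s x. 0 < s \<Longrightarrow> s \<le> \<delta> \<Longrightarrow> set_pmf (P s x) = set_pmf (P \<delta> x)"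
    using ex_constant_support by blast
  have trans: "(\<Union>y\<in>set_pmf (P \<delta> x). set_pmf (P \<delta> y)) = set_pmf (P \<delta> x)" for x
    using set_pmf_add[of "\<delta> / 2" "\<delta> / 2" x] \<delta>(1) \<delta>(2)[of "\<delta> / 2"] by simp
  \<comment> \<open>The multiples start at \<open>\<delta>\<close> itself: at time 0 the support is
    only \<open>{x}\<close>.\<close>
  have multiple: "set_pmf (P (real (Suc n) * \<delta>) x) = set_pmf (P \<delta> x)" for n x
  proof (induction n)
    case 0
    then show ?case by simp
  next
    case (Suc n)
    have "P (real (Suc (Suc n)) * \<delta>) x = P (real (Suc n) * \<delta> + \<delta>) x"
      by (simp add: algebra_simps)
    then show ?case
      using Suc \<delta>(1) trans[of x] set_pmf_add[of "real (Suc n) * \<delta>" \<delta> x] by simp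
  qed
  \<comment> \<open>Monotonicity squeezes the support at \<open>u\<close> between those at
    \<open>min u \<delta>\<close> and at a multiple of \<open>\<delta>\<close> beyond
    \<open>u\<close>, which agree.\<close>
  have "set_pmf (P u x) = set_pmf (P \<delta> x)" if u: "0 < u" for u
  proof
    obtain n where "u / \<delta> < real n"
      using reals_Archimedean2 by blast
    then have "u \<le> real (Suc n) * \<delta>"
      using \<delta>(1) by (simp add: field_simps)
    then show "set_pmf (P u x) \<subseteq> set_pmf (P \<delta> x)"
      using set_pmf_mono[of u "real (Suc n) * \<delta>" x] multiple[of n x] u by simp
    have "set_pmf (P (min u \<delta>) x) = set_pmf (P \<delta> x)"
      using u \<delta>(1) by (intro \<delta>(2)) auto
    then show "set_pmf (P \<delta> x) \<subseteq> set_pmf (P u x)"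
      using set_pmf_mono[of "min u \<delta>" u x] u \<delta>(1) by simp
  qed
  then show ?thesis
    using assms by simp
qed

section \<open>Reachability and closed irreducible classes\<close>

lemma leads_to_iff:
  assumes "0 < t"
  shows "leads_to P x y \<longleftrightarrow> y \<in> set_pmf (P t x)"
proof
  assume "leads_to P x y"
  then obtain s where s: "0 \<le> s" "y \<in> set_pmf (P s x)"
    by (auto simp: leads_to_def set_pmf_iff)
  \<comment> \<open>The time \<open>s\<close> may be 0, where time independence fails; adding
    \<open>t\<close> makes it positive.\<close>
  then have "y \<in> set_pmf (P (s + t) x)"
    using set_pmf_mono[of s "s + t" x] assms by auto
  then show "y \<in> set_pmf (P t x)"
    using set_pmf_time_independent[of "s + t" t x] s(1) assms by simp
next
  assume "y \<in> set_pmf (P t x)"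
  then show "leads_to P x y"
    using assms unfolding leads_to_def by (auto intro!: exI[of _ t] simp: pmf_positive)
qed

lemma leads_to_refl: "leads_to P x x"
  using leads_to_iff[of 1 x x] in_set_pmf_refl[of 1 x] by simp

lemma leads_to_trans:
  assumes "leads_to P x y" "leads_to P y z"
  shows "leads_to P x z"
proof -
  have "z \<in> set_pmf (P (1 + 1) x)"
    using assms set_pmf_add[of 1 1 x] by (auto simp: leads_to_iff[of 1])
  then show ?thesis
    using leads_to_iff[of "1 + 1" x z] by simp
qed

text \<open>Among the states reachable from \<open>x\<close>, one with the fewest reachable states
  works: moving on from it cannot shrink its reachable set, so every state in that set leads back to
  all of it.\<close>

lemma ex_reachable_closed_irreducible_class:
  "\<exists>C. closed_irreducible_class P C \<and> (\<forall>z\<in>C. leads_to P x z)"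
proof -
  define reach where "reach y = {z. leads_to P y z}" for y
  obtain y where y: "leads_to P x y" "\<And>w. leads_to P x w \<Longrightarrow> card (reach y) \<le> card (reach w)"
    using ex_has_least_nat[of "leads_to P x" x "\<lambda>y. card (reach y)"] leads_to_refl by auto
  have same: "reach w = reach y" if "leads_to P y w" for w
  proof (rule card_seteq)
    show "reach w \<subseteq> reach y"
      using that by (auto simp: reach_def intro: leads_to_trans)
    show "card (reach y) \<le> card (reach w)"
      using y that by (blast intro: leads_to_trans)
  qed simp
  have "closed_irreducible_class P (reach y)"
    unfolding closed_irreducible_class_def
  proof (intro conjI ballI allI impI)
    show "reach y \<noteq> {}"
      using leads_to_refl by (auto simp: reach_def)
    show "leads_to P a b" if "a \<in> reach y" "b \<in> reach y" for a b
      using same[of a] that by (auto simp: reach_def)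
    show "b \<in> reach y" if "a \<in> reach y" "leads_to P a b" for a b
      using that by (auto simp: reach_def intro: leads_to_trans)
  qed
  moreover have "\<forall>z\<in>reach y. leads_to P x z"
    using y(1) by (auto simp: reach_def intro: leads_to_trans)
  ultimately show ?thesis by blast
qed

text \<open>Each starting state reaches some closed irreducible class, and by uniqueness it is
  always the same one, so any \<open>z\<close> in it is reached from everywhere. Finiteness of the
  state space gives a positive minimum over the rows.\<close>

lemma unique_class_uniformly_positive:
  assumes "\<exists>!C. closed_irreducible_class P C" "0 < t"
  shows "\<exists>z \<epsilon>. 0 < \<epsilon> \<and> (\<forall>x. \<epsilon> \<le> pmf (P t x) z)"
proof -
  obtain C where C: "closed_irreducible_class P C" "\<And>D. closed_irreducible_class P D \<Longrightarrow> D = C"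
    using assms(1) by blast
  obtain z where z: "z \<in> C"
    using C(1) by (auto simp: closed_irreducible_class_def)
  have "leads_to P x z" for x
    using ex_reachable_closed_irreducible_class[of x] C(2) z by blast
  then have pos: "0 < pmf (P t x) z" for x
    using leads_to_iff[OF assms(2)] by (simp add: pmf_positive)
  define \<epsilon> where "\<epsilon> = Min (range (\<lambda>x. pmf (P t x) z))"
  have "0 < \<epsilon>"
    unfolding \<epsilon>_def using pos by (subst Min_gr_iff) auto
  moreover have "\<epsilon> \<le> pmf (P t x) z" for x
    unfolding \<epsilon>_def by (rule Min_le) auto
  ultimately show ?thesis by blast
qed

end

theorem lemma5p3:
  fixes P :: "real \<Rightarrow> 'e::finite \<Rightarrow> 'e pmf"
    and Pr :: "'e pmf \<Rightarrow> 'w measure"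
    and X :: "real \<Rightarrow> 'w \<Rightarrow> 'e"
    and \<mu> \<nu> :: "'e pmf"
  assumes "ctmc P Pr X"
    and "\<exists>!C. closed_irreducible_class P C"
    and "\<mu> \<noteq> \<nu>"
  shows "(\<forall>t>0. d_TV (measure_pmf \<mu>) (measure_pmf \<nu>)
              > d_TV (law_at Pr X \<mu> t) (law_at Pr X \<nu> t)) \<and>
         (stationary Pr X \<nu> \<longrightarrow>
           (\<forall>t>0. d_TV (measure_pmf \<mu>) (measure_pmf \<nu>)
                > d_TV (law_at Pr X \<mu> t) (measure_pmf \<nu>)))"
proof -
  interpret ctmc P Pr X by (rule assms(1))
  have strict: "d_TV (law_at Pr X \<mu> t) (law_at Pr X \<nu> t) < d_TV (measure_pmf \<mu>) (measure_pmf \<nu>)"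
    if t: "0 < t" for t
  proof -
    obtain z \<epsilon> where \<epsilon>: "0 < \<epsilon>" "\<And>x. \<epsilon> \<le> pmf (P t x) z"
      using unique_class_uniformly_positive[OF assms(2) t] by blast
    have "d_TV (law_at Pr X \<mu> t) (law_at Pr X \<nu> t)
        \<le> (1 - \<epsilon>) * d_TV (measure_pmf \<mu>) (measure_pmf \<nu>)"
      using t d_TV_bind_pmf_le[of \<epsilon> "P t" z \<mu> \<nu>] \<epsilon>(2) by (simp add: law_at_eq_bind_pmf)
    \<comment> \<open>Strictness uses that the initial distance is positive, which is where
      \<open>\<mu> \<noteq> \<nu>\<close> enters.\<close>
    also have "\<dots> < d_TV (measure_pmf \<mu>) (measure_pmf \<nu>)"
      using \<epsilon>(1) d_TV_pmf_pos[OF assms(3)] by (simp add: algebra_simps)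
    finally show ?thesis .
  qed
  moreover have "law_at Pr X \<nu> t = measure_pmf \<nu>" if "stationary Pr X \<nu>" "0 < t" for t
    using that by (simp add: stationary_def)
  ultimately show ?thesis
    by (metis (no_types))
qed

end
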